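(* For each finite commutative unital ring $K$, let $\approx_K$ be an equivalence relation on the set $K$, and let $[a]_{\approx_K}$ denote the class of $a\in K$. Suppose that the family $\{\approx_K\}_{K\in \mathrm{obj}\,\mathbf{FinCRing}}$ induces a well-defined functor $F:\mathbf{FinCRing}\to\mathbf{Graph}$ in the following way: (1) for every $K\in\mathrm{obj}\,\mathbf{FinCRing}$, the vertices of $F(K)$ are the equivalence classes of $\approx_K$, and there is an edge between the (not necessarily distinct) vertices $[a]_{\approx_K}$ and $[b]_{\approx_K}$ if and only if $ab=0$; (2) for every morphism $f\in\mathbf{FinCRing}(K,L)$ we have $F(f)([a]_{\approx_K})=[f(a)]_{\approx_L}$ for all $a \in K$. Then, for every finite commutative unital ring $K$ and all $a,b\in K$, $a\approx_K b$ implies $a\sim b$, i.e. $a=bu$ for some invertible element $u\in K$.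
   Context: $\mathbf{FinCRing}$ is the category of finite commutative unital rings (the zero ring is included) with ring homomorphisms preserving the identity element. $\mathbf{Graph}$ is the category of undirected graphs (loops allowed, no multiple edges or multiple loops) and graph morphisms, i.e. vertex maps sending adjacent (possibly equal) vertices to adjacent (possibly equal) vertices. "Well-defined" means that in (1) the condition $ab=0$ depends only on the classes $[a]_{\approx_K}$ and $[b]_{\approx_K}$, and that in (2) the class $[f(a)]_{\approx_L}$ depends only on the class $[a]_{\approx_K}$. The associatedness relation $\sim$ on $K$ is defined by $a\sim b$ if and only if $a=bu$ for some invertible $u\in K$. *)

theory Defs
  imports "HOL-Algebra.RingHom" "HOL-Library.FuncSet" "Graph_Theory.Pair_Digraph"
begin

text \<open>
  A family indexed by \<^emph>\<open>all\<close> finite rings is indexed by a proper class. Here the objects are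
  the finite commutative rings whose carrier is a subset of a type \<open>'a\<close>. When \<open>'a\<close> is infinite,
  every finite ring is isomorphic to one of these, so they form a full subcategory of FinCRing
  that is equivalent to FinCRing. The zero ring is included, as \<open>cring\<close> does not ask for
  \<open>\<one> \<noteq> \<zero>\<close>.
\<close>

definition fin_cring :: "'a ring \<Rightarrow> bool" where
  "fin_cring K \<longleftrightarrow> cring K \<and> finite (carrier K)"

text \<open>
  Morphisms are extensional functions (\<open>undefined\<close> off the carrier), so that equality of
  morphisms is equality of functions; identities and composition are accordingly
  \<open>\<lambda>x\<in>carrier K. x\<close> and \<open>compose (carrier K) g f\<close>.
\<close>

definition ring_mor :: "'a ring \<Rightarrow> 'a ring \<Rightarrow> ('a \<Rightarrow> 'a) set" where
  "ring_mor K L = ring_hom K L \<inter> extensional (carrier K)"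

text \<open>
  An undirected graph with loops allowed and without multiple edges or multiple loops is a
  vertex set with a symmetric relation on it, i.e. a \<open>pair_sym_digraph\<close>: vertices \<open>u\<close> and \<open>v\<close>
  are adjacent iff \<open>(u, v) \<in> parcs G\<close>, and an edge between distinct vertices is represented
  by its two orientations.
\<close>

definition graph_mor ::
    "'v pair_pre_digraph \<Rightarrow> 'w pair_pre_digraph \<Rightarrow> ('v \<Rightarrow> 'w) set" where
  "graph_mor G H = {h \<in> pverts G \<rightarrow>\<^sub>E pverts H.
     \<forall>u\<in>pverts G. \<forall>v\<in>pverts G. (u, v) \<in> parcs G \<longrightarrow> (h u, h v) \<in> parcs H}"

locale fincring_graph_functor =
  fixes F_ob :: "'a ring \<Rightarrow> 'v pair_pre_digraph"
    and F_mor :: "'a ring \<Rightarrow> 'a ring \<Rightarrow> ('a \<Rightarrow> 'a) \<Rightarrow> 'v \<Rightarrow> 'v"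
  assumes ob: "fin_cring K \<Longrightarrow> pair_sym_digraph (F_ob K)"
    and mor: "\<lbrakk>fin_cring K; fin_cring L; f \<in> ring_mor K L\<rbrakk>
      \<Longrightarrow> F_mor K L f \<in> graph_mor (F_ob K) (F_ob L)"
    and ident: "fin_cring K
      \<Longrightarrow> F_mor K K (\<lambda>x\<in>carrier K. x) = (\<lambda>v\<in>pverts (F_ob K). v)"
    and comp: "\<lbrakk>fin_cring K; fin_cring L; fin_cring M; f \<in> ring_mor K L; g \<in> ring_mor L M\<rbrakk>
      \<Longrightarrow> F_mor K M (compose (carrier K) g f)
        = compose (pverts (F_ob K)) (F_mor L M g) (F_mor K L f)"

text \<open>
  The family of equivalence relations is \<open>E\<close>, and the class of \<open>a\<close> in \<open>K\<close> is \<open>E K `` {a}\<close>.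
  As the conditions range over all representatives \<open>a\<close>, \<open>b\<close> of the classes, existence of such a
  functor includes that it is well-defined; see \<open>induces_functor_iff_well_defined\<close> below.
\<close>

definition induces_functor ::
    "('a ring \<Rightarrow> 'a rel) \<Rightarrow> ('a ring \<Rightarrow> 'a set pair_pre_digraph)
      \<Rightarrow> ('a ring \<Rightarrow> 'a ring \<Rightarrow> ('a \<Rightarrow> 'a) \<Rightarrow> 'a set \<Rightarrow> 'a set) \<Rightarrow> bool" where
  "induces_functor E F_ob F_mor \<longleftrightarrow>
     fincring_graph_functor F_ob F_mor \<and>
     (\<forall>K. fin_cring K \<longrightarrow>
        pverts (F_ob K) = carrier K // E K \<and>
        (\<forall>a\<in>carrier K. \<forall>b\<in>carrier K.
           (E K `` {a}, E K `` {b}) \<in> parcs (F_ob K) \<longleftrightarrow> a \<otimes>\<^bsub>K\<^esub> b = \<zero>\<^bsub>K\<^esub>)) \<and>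
     (\<forall>K L f. fin_cring K \<longrightarrow> fin_cring L \<longrightarrow> f \<in> ring_mor K L \<longrightarrow>
        (\<forall>a\<in>carrier K. F_mor K L f (E K `` {a}) = E L `` {f a}))"

definition well_defined_edges :: "('a ring \<Rightarrow> 'a rel) \<Rightarrow> bool" where
  "well_defined_edges E \<longleftrightarrow>
     (\<forall>K a a' b b'. fin_cring K \<longrightarrow> (a, a') \<in> E K \<longrightarrow> (b, b') \<in> E K \<longrightarrow>
        (a \<otimes>\<^bsub>K\<^esub> b = \<zero>\<^bsub>K\<^esub> \<longleftrightarrow> a' \<otimes>\<^bsub>K\<^esub> b' = \<zero>\<^bsub>K\<^esub>))"

definition well_defined_maps :: "('a ring \<Rightarrow> 'a rel) \<Rightarrow> bool" where
  "well_defined_maps E \<longleftrightarrow>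
     (\<forall>K L f a a'. fin_cring K \<longrightarrow> fin_cring L \<longrightarrow> f \<in> ring_mor K L \<longrightarrow>
        (a, a') \<in> E K \<longrightarrow> (f a, f a') \<in> E L)"

lemma ring_mor_closed: "f \<in> ring_mor K L \<Longrightarrow> a \<in> carrier K \<Longrightarrow> f a \<in> carrier L"
  by (auto simp: ring_mor_def ring_hom_def)

lemma ring_mor_id: "fin_cring K \<Longrightarrow> (\<lambda>x\<in>carrier K. x) \<in> ring_mor K K"
proof -
  assume "fin_cring K"
  then interpret cring K by (simp add: fin_cring_def)
  show ?thesis by (auto simp: ring_mor_def ring_hom_def)
qed

lemma ring_mor_compose:
  assumes "fin_cring K" and f: "f \<in> ring_mor K L" and g: "g \<in> ring_mor L M"
  shows "compose (carrier K) g f \<in> ring_mor K M"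
proof -
  interpret cring K using assms by (simp add: fin_cring_def)
  show ?thesis using f g
    by (auto simp: ring_mor_def ring_hom_def compose_def Pi_iff)
qed

theorem induces_functor_iff_well_defined:
  fixes E :: "'a ring \<Rightarrow> 'a rel"
  assumes eq: "\<And>K. fin_cring K \<Longrightarrow> equiv (carrier K) (E K)"
  shows "(\<exists>F_ob F_mor. induces_functor E F_ob F_mor)
    \<longleftrightarrow> well_defined_edges E \<and> well_defined_maps E"
proof
  assume "\<exists>F_ob F_mor. induces_functor E F_ob F_mor"
  then obtain F_ob F_mor where F: "induces_functor E F_ob F_mor" by blast
  have "well_defined_edges E"
    unfolding well_defined_edges_def
  proof (intro allI impI)
    fix K a a' b b'
    assume K: "fin_cring K" and a: "(a, a') \<in> E K" and b: "(b, b') \<in> E K"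
    have "a \<in> carrier K" "a' \<in> carrier K" "b \<in> carrier K" "b' \<in> carrier K"
      using eq[OF K] a b by (auto simp: equiv_def)
    moreover have "E K `` {a} = E K `` {a'}" "E K `` {b} = E K `` {b'}"
      using equiv_class_eq[OF eq[OF K]] a b by auto
    ultimately show "a \<otimes>\<^bsub>K\<^esub> b = \<zero>\<^bsub>K\<^esub> \<longleftrightarrow> a' \<otimes>\<^bsub>K\<^esub> b' = \<zero>\<^bsub>K\<^esub>"
      using F K unfolding induces_functor_def by metis
  qed
  moreover have "well_defined_maps E"
    unfolding well_defined_maps_def
  proof (intro allI impI)
    fix K L f a a'
    assume K: "fin_cring K" and L: "fin_cring L" and f: "f \<in> ring_mor K L"
      and a: "(a, a') \<in> E K"
    have c: "a \<in> carrier K" "a' \<in> carrier K"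
      using eq[OF K] a by (auto simp: equiv_def)
    moreover have "E K `` {a} = E K `` {a'}"
      using equiv_class_eq[OF eq[OF K]] a by auto
    ultimately have "E L `` {f a} = E L `` {f a'}"
      using F K L f unfolding induces_functor_def by metis
    then show "(f a, f a') \<in> E L"
      using eq_equiv_class[OF _ eq[OF L]] ring_mor_closed[OF f] c by metis
  qed
  ultimately show "well_defined_edges E \<and> well_defined_maps E" ..
next
  assume "well_defined_edges E \<and> well_defined_maps E"
  then have we: "well_defined_edges E" and wm: "well_defined_maps E" by auto
  define F_ob where "F_ob K = \<lparr>pverts = carrier K // E K,
      parcs = {(E K `` {a}, E K `` {b}) | a b.
        a \<in> carrier K \<and> b \<in> carrier K \<and> a \<otimes>\<^bsub>K\<^esub> b = \<zero>\<^bsub>K\<^esub>}\<rparr>" for K :: "'a ring"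
  define F_mor where "F_mor K L f = (\<lambda>A\<in>carrier K // E K. E L `` {f (SOME a. a \<in> A)})"
    for K L :: "'a ring" and f
  have arcs: "(E K `` {a}, E K `` {b}) \<in> parcs (F_ob K) \<longleftrightarrow> a \<otimes>\<^bsub>K\<^esub> b = \<zero>\<^bsub>K\<^esub>"
    if K: "fin_cring K" and a: "a \<in> carrier K" and b: "b \<in> carrier K" for K a b
  proof
    assume "(E K `` {a}, E K `` {b}) \<in> parcs (F_ob K)"
    then obtain a' b' where *: "E K `` {a} = E K `` {a'}" "E K `` {b} = E K `` {b'}"
      "a' \<in> carrier K" "b' \<in> carrier K" "a' \<otimes>\<^bsub>K\<^esub> b' = \<zero>\<^bsub>K\<^esub>"
      by (auto simp: F_ob_def)
    then have "(a, a') \<in> E K" "(b, b') \<in> E K"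
      using eq_equiv_class[OF _ eq[OF K]] by metis+
    then show "a \<otimes>\<^bsub>K\<^esub> b = \<zero>\<^bsub>K\<^esub>"
      using we K * unfolding well_defined_edges_def by blast
  next
    assume "a \<otimes>\<^bsub>K\<^esub> b = \<zero>\<^bsub>K\<^esub>"
    then show "(E K `` {a}, E K `` {b}) \<in> parcs (F_ob K)"
      using a b by (auto simp: F_ob_def)
  qed
  have val: "F_mor K L f (E K `` {a}) = E L `` {f a}"
    if K: "fin_cring K" and L: "fin_cring L" and f: "f \<in> ring_mor K L"
      and a: "a \<in> carrier K" for K L f a
  proof -
    have "a \<in> E K `` {a}" using equiv_class_self[OF eq[OF K] a] .
    then have "(SOME x. x \<in> E K `` {a}) \<in> E K `` {a}" by (rule someI)
    then have "(a, SOME x. x \<in> E K `` {a}) \<in> E K" by simp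
    then have "(f a, f (SOME x. x \<in> E K `` {a})) \<in> E L"
      using wm K L f unfolding well_defined_maps_def by blast
    then have "E L `` {f a} = E L `` {f (SOME x. x \<in> E K `` {a})}"
      by (rule equiv_class_eq[OF eq[OF L]])
    then show ?thesis using a by (simp add: F_mor_def quotientI)
  qed
  have verts [simp]: "pverts (F_ob K) = carrier K // E K" for K
    by (simp add: F_ob_def)
  have ext: "F_mor K L f \<in> extensional (carrier K // E K)" for K L f
    by (simp add: F_mor_def)
  have "fincring_graph_functor F_ob F_mor"
  proof (rule fincring_graph_functor.intro)
    fix K :: "'a ring" assume K: "fin_cring K"
    then interpret cring K by (simp add: fin_cring_def)
    have "sym (parcs (F_ob K))"
    proof (rule symI)
      fix A B assume "(A, B) \<in> parcs (F_ob K)"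
      then obtain a b where "A = E K `` {a}" "B = E K `` {b}"
        "a \<in> carrier K" "b \<in> carrier K" "a \<otimes>\<^bsub>K\<^esub> b = \<zero>\<^bsub>K\<^esub>"
        by (auto simp: F_ob_def)
      then show "(B, A) \<in> parcs (F_ob K)" using arcs[OF K] m_comm by simp
    qed
    moreover have "pair_wf_digraph (F_ob K)"
      by unfold_locales (auto simp: F_ob_def intro: quotientI)
    ultimately show "pair_sym_digraph (F_ob K)"
      by (simp add: pair_sym_digraph_def pair_sym_digraph_axioms_def symmetric_def)
  next
    fix K L :: "'a ring" and f
    assume K: "fin_cring K" and L: "fin_cring L" and f: "f \<in> ring_mor K L"
    have hom: "f (a \<otimes>\<^bsub>K\<^esub> b) = f a \<otimes>\<^bsub>L\<^esub> f b" if "a \<in> carrier K" "b \<in> carrier K" for a b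
      using f that by (auto simp: ring_mor_def ring_hom_def)
    have zero: "f \<zero>\<^bsub>K\<^esub> = \<zero>\<^bsub>L\<^esub>"
      using ring_hom_zero[of f K L] f K L
      by (auto simp: ring_mor_def fin_cring_def cring_def)
    have "F_mor K L f A \<in> carrier L // E L" if "A \<in> carrier K // E K" for A
      using that by (auto elim!: quotientE simp: val[OF K L f] intro!: quotientI ring_mor_closed[OF f])
    moreover have "(F_mor K L f A, F_mor K L f B) \<in> parcs (F_ob L)"
      if AB: "A \<in> carrier K // E K" "B \<in> carrier K // E K" and "(A, B) \<in> parcs (F_ob K)" for A B
    proof -
      obtain a b where ab: "a \<in> carrier K" "b \<in> carrier K" "A = E K `` {a}" "B = E K `` {b}"
        using AB by (auto elim!: quotientE)
      then have "a \<otimes>\<^bsub>K\<^esub> b = \<zero>\<^bsub>K\<^esub>" using that arcs[OF K] by simp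
      then have "f a \<otimes>\<^bsub>L\<^esub> f b = \<zero>\<^bsub>L\<^esub>" using hom ab zero by metis
      then show ?thesis
        using ab arcs[OF L] ring_mor_closed[OF f] val[OF K L f] by simp
    qed
    ultimately show "F_mor K L f \<in> graph_mor (F_ob K) (F_ob L)"
      using ext by (auto simp: graph_mor_def PiE_iff)
  next
    fix K :: "'a ring" assume K: "fin_cring K"
    show "F_mor K K (\<lambda>x\<in>carrier K. x) = (\<lambda>v\<in>pverts (F_ob K). v)"
    proof (rule extensionalityI[where A = "carrier K // E K"])
      fix A assume "A \<in> carrier K // E K"
      then show "F_mor K K (\<lambda>x\<in>carrier K. x) A = (\<lambda>v\<in>pverts (F_ob K). v) A"
        by (auto elim!: quotientE simp: val[OF K K ring_mor_id[OF K]] intro: quotientI)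
    qed (use ext in auto)
  next
    fix K L M :: "'a ring" and f g
    assume K: "fin_cring K" and L: "fin_cring L" and M: "fin_cring M"
      and f: "f \<in> ring_mor K L" and g: "g \<in> ring_mor L M"
    show "F_mor K M (compose (carrier K) g f)
        = compose (pverts (F_ob K)) (F_mor L M g) (F_mor K L f)"
    proof (rule extensionalityI[where A = "carrier K // E K"])
      fix A assume A: "A \<in> carrier K // E K"
      then obtain a where a: "a \<in> carrier K" "A = E K `` {a}" by (auto elim!: quotientE)
      then show "F_mor K M (compose (carrier K) g f) A
          = compose (pverts (F_ob K)) (F_mor L M g) (F_mor K L f) A"
        using A val[OF K M ring_mor_compose[OF K f g]] val[OF K L f] val[OF L M g]
          ring_mor_closed[OF f] by (simp add: compose_def)
    qed (use ext in \<open>auto simp: compose_def\<close>)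
  qed
  then have "induces_functor E F_ob F_mor"
    using arcs val by (simp add: induces_functor_def)
  then show "\<exists>F_ob F_mor. induces_functor E F_ob F_mor" by blast
qed

end

theory Submission
  imports Defs "HOL-Algebra.Weak_Morphisms"
begin

text \<open>
  A family that is well-defined on edges and on maps relates only elements with the same
  annihilator, in \<open>K\<close> and in every quotient of \<open>K\<close>. If \<open>a \<approx> b\<close>, then in \<open>K / (b)\<close> the class
  of \<open>b\<close>, hence also that of \<open>a\<close>, is annihilated by \<open>1\<close>, so \<open>a \<in> (b)\<close>; by symmetry
  \<open>(a) = (b)\<close>. Write \<open>a = bx\<close> and \<open>b = ay\<close> and let \<open>e\<close> be an idempotent power of \<open>xy\<close>. Then
  \<open>e\<close> fixes \<open>a\<close> and \<open>b\<close>, and \<open>u = xe + (1 - e)\<close> is a unit with \<open>a = bu\<close>.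
\<close>

text \<open>By pigeonhole two powers of \<open>x\<close> coincide, so the powers are eventually
  periodic. The exponent has the form \<open>Suc n\<close> so that a factor \<open>x\<close> can be
  split off an idempotent power.\<close>

lemma (in monoid) finite_idempotent_power:
  assumes fin: "finite (carrier G)" and x: "x \<in> carrier G"
  obtains n :: nat where "x [^] Suc n \<otimes> x [^] Suc n = x [^] Suc n"
proof -
  have "range (\<lambda>n::nat. x [^] n) \<subseteq> carrier G" using x by auto
  then have "\<not> inj (\<lambda>n::nat. x [^] n)"
    using fin finite_subset finite_imageD infinite_UNIV_nat by metis
  then obtain i j :: nat where "x [^] i = x [^] j" "i < j"
    by (metis injI linorder_neqE_nat)
  then obtain p where p: "x [^] (i + Suc p) = x [^] i"
    using less_imp_Suc_add by (metis add_Suc_right)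
  have period: "x [^] (i + m + k * Suc p) = x [^] (i + m)" for m k
  proof (induction k)
    case (Suc k)
    have "x [^] (i + m + Suc k * Suc p) = x [^] (i + Suc p) \<otimes> x [^] (m + k * Suc p)"
      by (simp only: nat_pow_mult[OF x] mult_Suc ac_simps)
    also have "\<dots> = x [^] (i + m + k * Suc p)"
      by (simp only: p nat_pow_mult[OF x] ac_simps)
    finally show ?case using Suc.IH by simp
  qed simp
  \<comment> \<open>A positive multiple of the period \<open>Suc p\<close> that is at least the
    preperiod \<open>i\<close>; hence exponents \<open>N\<close> and \<open>N + N\<close> give the
    same power.\<close>
  define N where "N = Suc i * Suc p"
  have N: "N = i + (N - i)" by (simp add: N_def)
  have "x [^] N \<otimes> x [^] N = x [^] (i + (N - i) + Suc i * Suc p)"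
    using nat_pow_mult[OF x] N unfolding N_def[symmetric] by metis
  also have "\<dots> = x [^] N" using period N by metis
  finally show ?thesis using that[of "N - 1"] by (simp add: N_def)
qed

lemma (in cring) finite_associated_by_unit:
  assumes fin: "finite (carrier R)"
    and [simp]: "a \<in> carrier R" "b \<in> carrier R"
    and ab: "a \<in> PIdl b" and ba: "b \<in> PIdl a"
  obtains u where "u \<in> Units R" "a = b \<otimes> u"
proof -
  \<comment> \<open>The expansion is a polynomial identity valid for arbitrary \<open>e\<close>; the
    idempotence of \<open>e\<close> is substituted only afterwards.\<close>
  have unit: "(x \<otimes> e \<oplus> (\<one> \<ominus> e)) \<otimes> (z \<otimes> e \<oplus> (\<one> \<ominus> e)) =
     x \<otimes> z \<otimes> (e \<otimes> e) \<oplus> (x \<oplus> z) \<otimes> (e \<otimes> (\<one> \<ominus> e)) \<oplus> (\<one> \<ominus> e \<ominus> e \<otimes> (\<one> \<ominus> e))"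
    if "x \<in> carrier R" "z \<in> carrier R" "e \<in> carrier R" for x z e
    using that by algebra
  obtain x y where x [simp]: "x \<in> carrier R" and y [simp]: "y \<in> carrier R"
    and a: "a = x \<otimes> b" and b: "b = y \<otimes> a"
    using ab ba by (auto simp: cgenideal_def)
  obtain n :: nat where idem: "(x \<otimes> y) [^] Suc n \<otimes> (x \<otimes> y) [^] Suc n = (x \<otimes> y) [^] Suc n"
    using finite_idempotent_power[OF fin] by (metis x y m_closed)
  \<comment> \<open>\<open>w\<close> is one power short of \<open>e\<close>, so that
    \<open>y \<otimes> w\<close> inverts \<open>x\<close> on the component cut out by
    \<open>e\<close>.\<close>
  define w e where "w = (x \<otimes> y) [^] n" and "e = (x \<otimes> y) [^] Suc n"
  have [simp]: "w \<in> carrier R" "e \<in> carrier R" by (simp_all add: w_def e_def)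
  have e: "e = x \<otimes> (y \<otimes> w)" by (simp add: e_def w_def m_ac)
  have ee: "e \<otimes> e = e" using idem by (simp only: e_def)
  have "b \<otimes> (x \<otimes> y) = b" using a b by (metis x y assms(3) m_comm m_assoc m_closed)
  then have "b \<otimes> (x \<otimes> y) [^] k = b" for k :: nat
    by (induction k) (simp_all add: m_assoc[symmetric])
  then have be: "b \<otimes> e = b" by (simp only: e_def)
  have orth: "e \<otimes> (\<one> \<ominus> e) = \<zero>"
    using ee by (simp add: minus_eq r_distr r_minus r_neg)
  \<comment> \<open>On the component of \<open>e\<close> these are \<open>x\<close> and its inverse
    \<open>y \<otimes> w\<close>; on the complementary component both are the identity.\<close>
  define u v where "u = x \<otimes> e \<oplus> (\<one> \<ominus> e)" and "v = y \<otimes> w \<otimes> e \<oplus> (\<one> \<ominus> e)"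
  have [simp]: "u \<in> carrier R" "v \<in> carrier R" by (simp_all add: u_def v_def)
  have "u \<otimes> v = x \<otimes> (y \<otimes> w) \<otimes> (e \<otimes> e) \<oplus> (x \<oplus> y \<otimes> w) \<otimes> (e \<otimes> (\<one> \<ominus> e))
      \<oplus> (\<one> \<ominus> e \<ominus> e \<otimes> (\<one> \<ominus> e))"
    unfolding u_def v_def by (simp add: unit)
  also have "\<dots> = e \<oplus> (\<one> \<ominus> e)"
    by (simp add: e[symmetric] ee orth minus_eq[of _ \<zero>])
  also have "\<dots> = \<one>" using \<open>e \<in> carrier R\<close> by algebra
  finally have "u \<otimes> v = \<one>" .
  moreover have "v \<otimes> u = u \<otimes> v" by (simp add: m_comm)
  ultimately have "u \<in> Units R"
    unfolding Units_def using \<open>u \<in> carrier R\<close> \<open>v \<in> carrier R\<close> by auto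
  moreover have "b \<otimes> u = x \<otimes> (b \<otimes> e) \<oplus> (b \<ominus> b \<otimes> e)"
    using x \<open>e \<in> carrier R\<close> assms(3) unfolding u_def by algebra
  then have "a = b \<otimes> u" using a by (simp add: be minus_eq r_neg)
  ultimately show ?thesis by (rule that)
qed

text \<open>
  The library's quotient ring has carrier type \<open>'a set\<close>; choosing representatives of the cosets
  moves it back to the type \<open>'a\<close>, over which the family of relations is indexed.
\<close>

lemma fin_cring_quotient_mor:
  assumes K: "fin_cring K" and I: "ideal I K"
  obtains L f where "fin_cring L" "f \<in> ring_mor K L"
    "\<And>x. x \<in> carrier K \<Longrightarrow> f x = \<zero>\<^bsub>L\<^esub> \<longleftrightarrow> x \<in> I"
proof -
  interpret cring K using K by (simp add: fin_cring_def)
  interpret I: ideal I K by (rule I)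
  define f where "f = (\<lambda>x\<in>carrier K. SOME y. y \<in> I +>\<^bsub>K\<^esub> x)"
  have rep: "f x \<in> I +>\<^bsub>K\<^esub> x" if "x \<in> carrier K" for x
    using I.a_rcos_self[OF that] that by (auto simp: f_def intro: someI)
  \<comment> \<open>The chosen representative depends only on the coset, and distinct cosets are
    disjoint, so \<open>f\<close> identifies exactly the elements congruent modulo
    \<open>I\<close>.\<close>
  have weak: "weak_ring_morphism f I K"
  proof (rule weak_ring_morphismI[OF I])
    fix x y assume xy: "x \<in> carrier K" "y \<in> carrier K"
    have "f x = f y \<longleftrightarrow> I +>\<^bsub>K\<^esub> x = I +>\<^bsub>K\<^esub> y"
    proof
      assume "f x = f y"
      then show "I +>\<^bsub>K\<^esub> x = I +>\<^bsub>K\<^esub> y"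
        using rep xy I.a_repr_independence' by metis
    qed (use xy in \<open>simp add: f_def\<close>)
    then show "f x = f y \<longleftrightarrow> x \<ominus>\<^bsub>K\<^esub> y \<in> I"
      using quotient_eq_iff_same_a_r_cos[OF I] xy by simp
  qed
  define L where "L = image_ring f K"
  have f: "f \<in> ring_hom K L" and "ring L" and ker: "a_kernel K L f = I"
    using weak_ring_morphism_is_hom[OF weak] image_ring_is_ring[OF weak]
      weak_ring_morphism_ker[OF weak] by (simp_all add: L_def)
  have carr: "carrier L = f ` carrier K" by (simp add: L_def image_ring_carrier)
  interpret L: ring L by fact
  have "cring L"
  proof (rule cring.intro, fact)
    show "comm_monoid L"
      by (rule L.monoid_comm_monoidI) (auto simp: carr m_comm simp flip: ring_hom_mult[OF f])
  qed
  then have "fin_cring L" using K carr by (simp add: fin_cring_def)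
  moreover have "f \<in> ring_mor K L" using f by (simp add: ring_mor_def f_def)
  moreover have "f x = \<zero>\<^bsub>L\<^esub> \<longleftrightarrow> x \<in> I" if "x \<in> carrier K" for x
    using that unfolding ker[symmetric] a_kernel_def' by simp
  ultimately show ?thesis by (rule that)
qed

lemma well_defined_mem_cgenideal:
  assumes edges: "well_defined_edges E" and maps: "well_defined_maps E"
    and eq: "\<And>K. fin_cring K \<Longrightarrow> equiv (carrier K) (E K)"
    and K: "fin_cring K" and ab: "(a, b) \<in> E K"
  shows "a \<in> PIdl\<^bsub>K\<^esub> b"
proof -
  interpret cring K using K by (simp add: fin_cring_def)
  have a: "a \<in> carrier K" and b: "b \<in> carrier K"
    using eq[OF K] ab by (auto simp: equiv_def)
  obtain L f where L: "fin_cring L" and f: "f \<in> ring_mor K L"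
    and ker: "\<And>x. x \<in> carrier K \<Longrightarrow> f x = \<zero>\<^bsub>L\<^esub> \<longleftrightarrow> x \<in> PIdl\<^bsub>K\<^esub> b"
    using fin_cring_quotient_mor[OF K cgenideal_ideal[OF b]] by metis
  interpret L: cring L using L by (simp add: fin_cring_def)
  have "(f a, f b) \<in> E L" using maps K L f ab by (auto simp: well_defined_maps_def)
  \<comment> \<open>Testing edges against the class of \<open>1\<close> makes vanishing invariant
    under the relation, and \<open>f b\<close> vanishes because \<open>b\<close> lies in its own
    principal ideal.\<close>
  moreover have "(\<one>\<^bsub>L\<^esub>, \<one>\<^bsub>L\<^esub>) \<in> E L" using eq[OF L] by (auto simp: equiv_def refl_on_def)
  ultimately have "f a \<otimes>\<^bsub>L\<^esub> \<one>\<^bsub>L\<^esub> = \<zero>\<^bsub>L\<^esub> \<longleftrightarrow> f b \<otimes>\<^bsub>L\<^esub> \<one>\<^bsub>L\<^esub> = \<zero>\<^bsub>L\<^esub>"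
    using edges L unfolding well_defined_edges_def by blast
  then show ?thesis
    using ker a b ring_mor_closed[OF f] cgenideal_self[OF b] by simp
qed

theorem proposition3p1:
  fixes E :: "'a ring \<Rightarrow> 'a rel"
    and F_ob :: "'a ring \<Rightarrow> 'a set pair_pre_digraph"
    and F_mor :: "'a ring \<Rightarrow> 'a ring \<Rightarrow> ('a \<Rightarrow> 'a) \<Rightarrow> 'a set \<Rightarrow> 'a set"
  assumes "infinite (UNIV :: 'a set)"
    and "\<And>K. fin_cring K \<Longrightarrow> equiv (carrier K) (E K)"
    and "induces_functor E F_ob F_mor"
  shows "\<forall>K. fin_cring K \<longrightarrow>
    (\<forall>a\<in>carrier K. \<forall>b\<in>carrier K. (a, b) \<in> E K \<longrightarrow> (\<exists>u\<in>Units K. a = b \<otimes>\<^bsub>K\<^esub> u))"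
proof (intro allI ballI impI)
  fix K :: "'a ring" and a b
  assume K: "fin_cring K" and a: "a \<in> carrier K" and b: "b \<in> carrier K" and ab: "(a, b) \<in> E K"
  have wd: "well_defined_edges E" "well_defined_maps E"
    using induces_functor_iff_well_defined[OF assms(2)] assms(3) by blast+
  have "(b, a) \<in> E K" using assms(2)[OF K] ab by (auto simp: equiv_def dest: symD)
  then have "a \<in> PIdl\<^bsub>K\<^esub> b" "b \<in> PIdl\<^bsub>K\<^esub> a"
    using well_defined_mem_cgenideal[OF wd assms(2) K] ab by blast+
  then show "\<exists>u\<in>Units K. a = b \<otimes>\<^bsub>K\<^esub> u"
    using cring.finite_associated_by_unit[of K a b] K a b by (auto simp: fin_cring_def)
qed

end
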